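(* For any positive integers $n, i_1,\ldots,i_n$ we have $$\Omega(i_1,\ldots,i_n)=\sum_{k=1}^{n}\Omega(i_1,\ldots,i_{k-1},\,i_k-1,\,i_{k+1},\ldots,i_n),$$ i.e. $\Omega(i_1,\ldots,i_n)=\Omega(i_1-1,i_2,\ldots,i_n)+\Omega(i_1,i_2-1,i_3,\ldots,i_n)+\cdots+\Omega(i_1,\ldots,i_{n-1},i_n-1)$.
   Context: A permutation $\tau$ of $\{0,\ldots,N\}$ is said to increase (resp. decrease) on a set $\{p,\ldots,q\}\subseteq\{0,\ldots,N\}$ if $\tau(j)<\tau(j+1)$ (resp. $\tau(j)>\tau(j+1)$) for every $j=p,\ldots,q-1$ (vacuous when $p=q$). For a finite sequence $a_1,\ldots,a_m$ of nonnegative integers ($m\ge1$), put $N:=a_1+\cdots+a_m$, $t_0:=0$, $t_k:=a_1+\cdots+a_k$. Then $\Omega(a_1,\ldots,a_m)$ denotes the number of permutations of $\{0,\ldots,N\}$ which, for every $k=1,\ldots,m$, increase on $\{t_{k-1},\ldots,t_k\}$ if $k$ is odd and decrease on $\{t_{k-1},\ldots,t_k\}$ if $k$ is even. *)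

theory Defs
  imports Main "HOL-Combinatorics.Permutations"
begin

definition increases_on :: "(nat \<Rightarrow> nat) \<Rightarrow> nat \<Rightarrow> nat \<Rightarrow> bool" where
  "increases_on \<tau> p q \<longleftrightarrow> (\<forall>j\<in>{p..<q}. \<tau> j < \<tau> (j + 1))"

definition decreases_on :: "(nat \<Rightarrow> nat) \<Rightarrow> nat \<Rightarrow> nat \<Rightarrow> bool" where
  "decreases_on \<tau> p q \<longleftrightarrow> (\<forall>j\<in>{p..<q}. \<tau> j > \<tau> (j + 1))"

definition breakpoint :: "nat list \<Rightarrow> nat \<Rightarrow> nat" where
  "breakpoint as k = sum_list (take k as)"

text \<open>
  Blocks are numbered from 1, although list positions are numbered from 0: block \<open>k\<close> has
  length \<open>as ! (k - 1)\<close>. A function that \<open>permutes {0..N}\<close> is the identity outside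
  \<open>{0..N}\<close>, so each permutation of \<open>{0..N}\<close> is counted exactly once.
\<close>

definition Omega :: "nat list \<Rightarrow> nat" where
  "Omega as = card {\<tau>. \<tau> permutes {0..sum_list as} \<and>
     (\<forall>k\<in>{1..length as}.
        (odd k \<longrightarrow> increases_on \<tau> (breakpoint as (k - 1)) (breakpoint as k)) \<and>
        (even k \<longrightarrow> decreases_on \<tau> (breakpoint as (k - 1)) (breakpoint as k)))}"

end

theory Submission imports Defs begin

text \<open>
  Record the shape of a permutation of \<open>{0..N}\<close> by its word of ascents (\<open>True\<close>) and descents
  (\<open>False\<close>); \<open>Omega\<close> then counts the permutations whose word has runs of the given lengths,
  beginning with a run of ascents. The maximum \<open>N\<close> can only sit at a peak, which is either the end
  of the word, when the last run ascends, or the boundary between an ascending and a descending run.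
  Removing \<open>N\<close> from the end shortens the last run. Removing it from a boundary merges the letters \<open>True, False\<close> around it into a single letter, which may be either
  one; the former case shortens the descending run, the latter the ascending run. Hence every run
  is shortened exactly once.
\<close>

section \<open>Words of ascents and descents\<close>

definition with_word :: "bool list \<Rightarrow> (nat \<Rightarrow> nat) set" where
  "with_word w = {\<tau>. \<tau> permutes {0..length w} \<and> (\<forall>j<length w. w ! j \<longleftrightarrow> \<tau> j < \<tau> (Suc j))}"

definition with_max_at :: "bool list \<Rightarrow> nat \<Rightarrow> (nat \<Rightarrow> nat) set" where
  "with_max_at w p = {\<tau> \<in> with_word w. \<tau> p = length w}"

text \<open>An entry 0 contributes no letters, so the runs on its two sides, which have the same
  direction, fuse. The shortened lists in the recurrence can contain such an entry.\<close>

fun runs :: "bool \<Rightarrow> nat list \<Rightarrow> bool list" where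
  "runs b [] = []"
| "runs b (a # as) = replicate a b @ runs (\<not> b) as"

section \<open>Possible positions of the maximum\<close>

lemma finite_with_word: "finite (with_word w)"
  by (rule finite_subset[OF _ finite_permutations[of "{0..length w}"]]) (auto simp: with_word_def)

lemma card_with_word_max:
  "card (with_word w) = (\<Sum>p\<in>{0..length w}. card (with_max_at w p))"
proof -
  have "\<exists>p\<le>length w. \<tau> p = length w" if "\<tau> permutes {0..length w}" for \<tau>
  proof -
    have "length w \<in> \<tau> ` {0..length w}"
      by (simp add: permutes_image[OF that])
    then show ?thesis by force
  qed
  then have "with_word w = (\<Union>p\<in>{0..length w}. with_max_at w p)"
    by (fastforce simp: with_max_at_def with_word_def)
  moreover have "with_max_at w p \<inter> with_max_at w q = {}" if "p \<noteq> q" for p q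
  proof -
    have False if "\<tau> permutes {0..length w}" "\<tau> p = \<tau> q" for \<tau>
      using permutes_inj[OF that(1), THEN injD, OF that(2)] \<open>p \<noteq> q\<close> by simp
    then show ?thesis
      by (simp add: with_max_at_def with_word_def disjoint_iff) metis
  qed
  moreover have "finite (with_max_at w p)" for p
    by (simp add: with_max_at_def finite_with_word)
  ultimately show ?thesis
    by (simp add: card_UN_disjoint)
qed

lemma with_word_le:
  assumes "\<tau> \<in> with_word w" and "j \<le> length w"
  shows "\<tau> j \<le> length w"
  using assms permutes_in_image[of \<tau> "{0..length w}" j] by (auto simp: with_word_def)

lemma with_max_at_ascent:
  assumes "p < length w" and "w ! p"
  shows "with_max_at w p = {}"
proof -
  have False if "\<tau> \<in> with_max_at w p" for \<tau>
  proof -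
    have "\<tau> \<in> with_word w" "\<tau> p = length w"
      using that by (auto simp: with_max_at_def)
    then show False
      using assms with_word_le[of \<tau> w "Suc p"] by (auto simp: with_word_def)
  qed
  then show ?thesis by blast
qed

lemma with_max_at_descent:
  assumes "p < length w" and "\<not> w ! p"
  shows "with_max_at w (Suc p) = {}"
proof -
  have False if "\<tau> \<in> with_max_at w (Suc p)" for \<tau>
  proof -
    have tau: "\<tau> \<in> with_word w" "\<tau> (Suc p) = length w"
      using that by (auto simp: with_max_at_def)
    \<comment> \<open>The letter \<open>False\<close> only denies an ascent from \<open>p\<close>;
      since the value at \<open>Suc p\<close> is already maximal, the two values must coincide,
      against injectivity.\<close>
    have "\<tau> p = \<tau> (Suc p)"
      using tau assms with_word_le[of \<tau> w p] by (auto simp: with_word_def)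
    then show False
      using tau(1) permutes_inj[THEN injD, of \<tau> "{0..length w}" p "Suc p"]
      by (auto simp: with_word_def)
  qed
  then show ?thesis by blast
qed

section \<open>Inserting the maximum at a given position\<close>

definition rotation :: "nat \<Rightarrow> nat \<Rightarrow> nat \<Rightarrow> nat" where
  "rotation p N j = (if j = p then N else if p < j \<and> j \<le> N then j - 1 else j)"

lemma rotation_permutes:
  assumes "p \<le> N"
  shows "rotation p N permutes {0..N}"
proof (rule bij_imp_permutes)
  show "bij_betw (rotation p N) {0..N} {0..N}"
    using assms
    by (intro bij_betw_byWitness[where f' = "\<lambda>j. if j = N then p else if p \<le> j then Suc j else j"])
       (auto simp: rotation_def)
next
  fix j assume "j \<notin> {0..N}"
  then show "rotation p N j = j"
    using assms by (simp add: rotation_def)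
qed

text \<open>A permutation of \<open>{0..m}\<close> also permutes \<open>{0..Suc m}\<close>, with
  \<open>Suc m\<close> as its last entry. Precomposing with the cycle \<open>rotation\<close> moves
  this entry to position \<open>p\<close> and pushes the entries from \<open>p\<close> on one place
  to the right; the inverse cycle undoes this.\<close>

lemma bij_betw_insert_max:
  assumes "p \<le> Suc m"
  shows "bij_betw (\<lambda>\<sigma>. \<sigma> \<circ> rotation p (Suc m)) {\<sigma>. \<sigma> permutes {0..m}}
    {\<tau>. \<tau> permutes {0..Suc m} \<and> \<tau> p = Suc m}"
proof -
  let ?r = "rotation p (Suc m)"
  have r: "?r permutes {0..Suc m}"
    using assms by (rule rotation_permutes)
  have r_p: "?r p = Suc m"
    by (simp add: rotation_def)
  show ?thesis
  proof (intro bij_betw_byWitness[where f' = "\<lambda>\<tau>. \<tau> \<circ> inv ?r"] ballI subsetI)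
    fix \<sigma> assume "\<sigma> \<in> {\<sigma>. \<sigma> permutes {0..m}}"
    show "(\<sigma> \<circ> ?r) \<circ> inv ?r = \<sigma>"
      by (simp add: comp_assoc permutes_inv_o[OF r])
  next
    fix \<tau>
    show "(\<tau> \<circ> inv ?r) \<circ> ?r = \<tau>"
      by (simp add: comp_assoc permutes_inv_o[OF r])
  next
    fix \<tau> assume "\<tau> \<in> (\<lambda>\<sigma>. \<sigma> \<circ> ?r) ` {\<sigma>. \<sigma> permutes {0..m}}"
    then obtain \<sigma> where s: "\<sigma> permutes {0..m}" and t: "\<tau> = \<sigma> \<circ> ?r" by blast
    have "\<sigma> permutes {0..Suc m}"
      by (rule permutes_subset[OF s]) simp
    then have "\<tau> permutes {0..Suc m}"
      unfolding t by (rule permutes_compose[OF r])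
    then show "\<tau> \<in> {\<tau>. \<tau> permutes {0..Suc m} \<and> \<tau> p = Suc m}"
      using permutes_not_in[OF s, of "Suc m"] by (simp add: t r_p)
  next
    fix \<sigma> assume "\<sigma> \<in> (\<lambda>\<tau>. \<tau> \<circ> inv ?r) ` {\<tau>. \<tau> permutes {0..Suc m} \<and> \<tau> p = Suc m}"
    then obtain \<tau> where t: "\<tau> permutes {0..Suc m}" "\<tau> p = Suc m" and s: "\<sigma> = \<tau> \<circ> inv ?r" by blast
    have s_perm: "\<sigma> permutes {0..Suc m}"
      unfolding s by (rule permutes_compose[OF permutes_inv[OF r] t(1)])
    have "\<sigma> (Suc m) = Suc m"
      using t(2) permutes_inverses(2)[OF r, of p] by (simp add: s r_p)
    then have "\<sigma> permutes {0..m}"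
      by (intro permutes_superset[OF s_perm]) (auto simp: le_Suc_eq)
    then show "\<sigma> \<in> {\<sigma>. \<sigma> permutes {0..m}}" by simp
  qed
qed

lemma card_with_max_at:
  assumes "p \<le> Suc m" and "length w = Suc m"
  shows "card (with_max_at w p) =
    card {\<sigma>. \<sigma> permutes {0..m} \<and> \<sigma> \<circ> rotation p (Suc m) \<in> with_word w}"
proof -
  let ?f = "\<lambda>\<sigma>. \<sigma> \<circ> rotation p (Suc m)"
  note bij = bij_betw_insert_max[OF assms(1)]
  have "with_max_at w p = ?f ` {\<sigma>. \<sigma> permutes {0..m} \<and> ?f \<sigma> \<in> with_word w}"
  proof -
    have "with_max_at w p =
        {\<tau> \<in> ?f ` {\<sigma>. \<sigma> permutes {0..m}}. \<tau> \<in> with_word w}"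
      unfolding bij_betw_imp_surj_on[OF bij]
      using assms(2) by (auto simp: with_max_at_def with_word_def)
    also have "\<dots> = ?f ` {\<sigma>. \<sigma> permutes {0..m} \<and> ?f \<sigma> \<in> with_word w}"
      by auto
    finally show ?thesis .
  qed
  moreover have "inj_on ?f {\<sigma>. \<sigma> permutes {0..m} \<and> ?f \<sigma> \<in> with_word w}"
    by (rule inj_on_subset[OF bij_betw_imp_inj_on[OF bij]]) auto
  ultimately show ?thesis by (simp add: card_image)
qed

text \<open>Insertion keeps the pairs of neighbours on either side of \<open>p\<close>, those on the
  right moving one place, and creates an ascent into the maximum and a descent out of it, where
  these exist. The neighbours \<open>p - 1\<close> and \<open>p\<close> of \<sigma> get separated,
  so no letter constrains their order.\<close>

lemma rotated_in_with_word:
  assumes "\<sigma> permutes {0..m}" and "p \<le> Suc m" and "length w = Suc m"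
  shows "\<sigma> \<circ> rotation p (Suc m) \<in> with_word w \<longleftrightarrow>
    (\<forall>j. Suc j < p \<longrightarrow> (w ! j \<longleftrightarrow> \<sigma> j < \<sigma> (Suc j))) \<and>
    (0 < p \<longrightarrow> w ! (p - 1)) \<and> (p \<le> m \<longrightarrow> \<not> w ! p) \<and>
    (\<forall>j. p \<le> j \<and> j < m \<longrightarrow> (w ! Suc j \<longleftrightarrow> \<sigma> j < \<sigma> (Suc j)))"
    (is "?L \<longleftrightarrow> ?R")
proof -
  let ?\<tau> = "\<sigma> \<circ> rotation p (Suc m)"
  have "?\<tau> permutes {0..Suc m}"
    using bij_betw_apply[OF bij_betw_insert_max[OF assms(2)]] assms(1) by blast
  then have L: "?L \<longleftrightarrow> (\<forall>j\<le>m. w ! j \<longleftrightarrow> ?\<tau> j < ?\<tau> (Suc j))"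
    using assms(3) by (simp add: with_word_def less_Suc_eq_le)
  have bound: "\<sigma> j < Suc m" if "j \<le> m" for j
    using permutes_in_image[OF assms(1), of j] that by simp
  have fixed: "\<sigma> (Suc m) = Suc m"
    using permutes_not_in[OF assms(1), of "Suc m"] by simp
  have low: "?\<tau> j = \<sigma> j" if "j < p" for j
    using that by (simp add: rotation_def)
  have mid: "?\<tau> p = Suc m"
    by (simp add: rotation_def fixed)
  have high: "?\<tau> (Suc j) = \<sigma> j" if "p \<le> j" "j \<le> m" for j
    using that by (simp add: rotation_def)
  \<comment> \<open>Letter \<open>p - 1\<close> leads into the maximum and letter \<open>p\<close>
    out of it; a letter beyond \<open>p\<close> is written \<open>Suc j\<close> since it compares
    the entries \<open>j\<close> and \<open>Suc j\<close> of \<sigma>.\<close>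
  have split: "(\<forall>j\<le>m. P j) \<longleftrightarrow> (\<forall>j. Suc j < p \<longrightarrow> P j) \<and> (0 < p \<longrightarrow> P (p - 1)) \<and>
      (p \<le> m \<longrightarrow> P p) \<and> (\<forall>j. p \<le> j \<and> j < m \<longrightarrow> P (Suc j))" for P
  proof (intro iffI conjI allI impI; (elim conjE)?)
    fix j assume P: "\<forall>j. Suc j < p \<longrightarrow> P j" "0 < p \<longrightarrow> P (p - 1)" "p \<le> m \<longrightarrow> P p"
      "\<forall>j. p \<le> j \<and> j < m \<longrightarrow> P (Suc j)" and j: "j \<le> m"
    consider "Suc j < p" | "Suc j = p" | "j = p" | "p < j" by linarith
    then show "P j"
    proof cases
      case 4
      then obtain i where "j = Suc i" "p \<le> i" by (cases j) auto
      then show ?thesis using P(4) j by simp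
    qed (use P j in auto)
  qed (use assms(2) in auto)
  have 1: "?\<tau> (p - 1) < ?\<tau> p" if "0 < p"
    using that assms(2) bound[of "p - 1"] by (simp only: mid low)
  have 2: "\<not> ?\<tau> p < ?\<tau> (Suc p)" if "p \<le> m"
    using that bound[of p] by (simp only: mid high not_less order.refl less_imp_le)
  show ?thesis
    unfolding L split using 1 2 by (auto simp del: comp_apply simp: low high)
qed

section \<open>Deleting the maximum from the end or from a peak\<close>

lemma card_max_at_end: "card (with_max_at (u @ [True]) (Suc (length u))) = card (with_word u)"
proof -
  have "{\<sigma>. \<sigma> permutes {0..length u} \<and>
      \<sigma> \<circ> rotation (Suc (length u)) (Suc (length u)) \<in> with_word (u @ [True])} = with_word u"
    by (auto simp: rotated_in_with_word with_word_def[of u] nth_append)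
  then show ?thesis
    using card_with_max_at[of "Suc (length u)" "length u" "u @ [True]"] by simp
qed

text \<open>Deleting the maximum makes the entries at \<open>length u\<close> and
  \<open>Suc (length u)\<close> adjacent, in free order. This order is the merged letter, so the
  permutations split into two disjoint classes by it.\<close>

lemma card_max_at_peak:
  "card (with_max_at (u @ [True, False] @ v) (Suc (length u))) =
    card (with_word (u @ [True] @ v)) + card (with_word (u @ [False] @ v))"
proof -
  let ?w = "u @ [True, False] @ v" and ?p = "Suc (length u)" and ?m = "Suc (length u + length v)"
  \<comment> \<open>Singles out the letter at \<open>length u\<close>, the only one in which the two
    shorter words differ.\<close>
  have word: "\<sigma> \<in> with_word (u @ [b] @ v) \<longleftrightarrow> \<sigma> permutes {0..?m} \<and>
      (\<forall>j<length u. u ! j \<longleftrightarrow> \<sigma> j < \<sigma> (Suc j)) \<and>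
      (b \<longleftrightarrow> \<sigma> (length u) < \<sigma> ?p) \<and>
      (\<forall>j. ?p \<le> j \<and> j < ?m \<longrightarrow> (v ! (j - ?p) \<longleftrightarrow> \<sigma> j < \<sigma> (Suc j)))" for \<sigma> b
  proof -
    have "(\<forall>j<?m. P j) \<longleftrightarrow>
        (\<forall>j<length u. P j) \<and> P (length u) \<and> (\<forall>j. ?p \<le> j \<and> j < ?m \<longrightarrow> P j)" for P
    proof (intro iffI conjI allI impI; (elim conjE)?)
      fix j assume P: "\<forall>j<length u. P j" "P (length u)" "\<forall>j. ?p \<le> j \<and> j < ?m \<longrightarrow> P j"
        and j: "j < ?m"
      consider "j < length u" | "j = length u" | "?p \<le> j" by linarith
      then show "P j"
        using P j by cases auto
    qed auto
    from this[of "\<lambda>j. (u @ [b] @ v) ! j \<longleftrightarrow> \<sigma> j < \<sigma> (Suc j)"] show ?thesis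
      by (auto simp: with_word_def nth_append)
  qed
  have "\<sigma> \<circ> rotation ?p (Suc ?m) \<in> with_word ?w \<longleftrightarrow>
      (\<forall>j<length u. u ! j \<longleftrightarrow> \<sigma> j < \<sigma> (Suc j)) \<and>
      (\<forall>j. ?p \<le> j \<and> j < ?m \<longrightarrow> (v ! (j - ?p) \<longleftrightarrow> \<sigma> j < \<sigma> (Suc j)))"
    if "\<sigma> permutes {0..?m}" for \<sigma>
    using rotated_in_with_word[OF that, of ?p ?w]
    by (auto simp: nth_append nth_Cons' Suc_diff_le)
  then have "{\<sigma>. \<sigma> permutes {0..?m} \<and> \<sigma> \<circ> rotation ?p (Suc ?m) \<in> with_word ?w} =
      with_word (u @ [True] @ v) \<union> with_word (u @ [False] @ v)"
    unfolding set_eq_iff Un_iff word mem_Collect_eq by blast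
  moreover have "with_word (u @ [True] @ v) \<inter> with_word (u @ [False] @ v) = {}"
    unfolding disjoint_iff word by blast
  ultimately show ?thesis
    using card_with_max_at[of ?p ?m ?w] by (simp add: card_Un_disjoint finite_with_word)
qed

section \<open>Summation over the runs\<close>

lemma sum_max_at_run_pair:
  assumes "a \<ge> 1" and "b \<ge> 1"
  shows "(\<Sum>p\<in>{length u<..length u + a + b}.
      card (with_max_at (u @ replicate a True @ replicate b False @ v) p)) =
    card (with_word (u @ replicate (a - 1) True @ replicate b False @ v)) +
    card (with_word (u @ replicate a True @ replicate (b - 1) False @ v))"
proof -
  let ?w = "u @ replicate a True @ replicate b False @ v"
  obtain a' b' where ab: "a = Suc a'" "b = Suc b'"
    using assms by (metis Suc_le_D One_nat_def)
  \<comment> \<open>Before the top of the pair of runs, \<open>p\<close> starts an ascent; after it,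
    \<open>p\<close> ends a descent.\<close>
  have "with_max_at ?w p = {}"
    if "p \<in> {length u<..length u + a + b} - {length u + a}" for p
  proof (cases "p < length u + a")
    case True
    then show ?thesis
      using that by (intro with_max_at_ascent) (auto simp: nth_append)
  next
    case False
    with that have "length u + a < p" by simp
    then obtain q where "p = Suc q" "length u + a \<le> q"
      by (cases p) auto
    then show ?thesis
      using that by (auto intro!: with_max_at_descent simp: nth_append split: if_splits)
  qed
  then have "(\<Sum>p\<in>{length u<..length u + a + b}. card (with_max_at ?w p)) =
      (\<Sum>p\<in>{length u + a}. card (with_max_at ?w p))"
    using assms by (intro sum.mono_neutral_right) auto
  \<comment> \<open>The two letters at the peak come one from each run. Merged into
    \<open>True\<close> they leave \<open>a\<close> ascents and \<open>b - 1\<close> descents,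
    merged into \<open>False\<close> they leave \<open>a - 1\<close> and \<open>b\<close>.\<close>
  then show ?thesis
    using card_max_at_peak[of "u @ replicate a' True" "replicate b' False @ v"]
    by (simp add: ab replicate_app_Cons_same)
qed

lemma sum_max_at_last_run:
  assumes "a \<ge> 1"
  shows "(\<Sum>p\<in>{length u<..length u + a}. card (with_max_at (u @ replicate a True) p)) =
    card (with_word (u @ replicate (a - 1) True))"
proof -
  let ?w = "u @ replicate a True"
  obtain a' where a: "a = Suc a'"
    using assms by (metis Suc_le_D One_nat_def)
  have "with_max_at ?w p = {}" if "p \<in> {length u<..length u + a} - {length u + a}" for p
    using that by (intro with_max_at_ascent) (auto simp: nth_append)
  then have "(\<Sum>p\<in>{length u<..length u + a}. card (with_max_at ?w p)) =
      (\<Sum>p\<in>{length u + a}. card (with_max_at ?w p))"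
    using assms by (intro sum.mono_neutral_right) auto
  moreover have "?w = (u @ replicate a' True) @ [True]"
    by (simp add: a replicate_append_same)
  ultimately show ?thesis
    using card_max_at_end[of "u @ replicate a' True"] by (simp add: a)
qed

text \<open>Runs are stripped in pairs, so that the rest always begins with an ascending run;
  \<open>u\<close> collects the stripped letters. The intervals are open on the left because
  position \<open>length u\<close> is counted with the run that ends there.\<close>

lemma sum_max_at_runs:
  assumes "\<forall>a\<in>set as. a \<ge> 1"
  shows "(\<Sum>p\<in>{length u<..length u + sum_list as}. card (with_max_at (u @ runs True as) p)) =
    (\<Sum>k<length as. card (with_word (u @ runs True (as[k := as ! k - 1]))))"
  using assms
proof (induction as arbitrary: u rule: induct_list012)
  case 1
  then show ?case by simp
next
  case (2 a)
  then show ?case using sum_max_at_last_run[of a u] by simp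
next
  case (3 a b as)
  let ?u = "u @ replicate a True @ replicate b False"
  let ?f = "\<lambda>p. card (with_max_at (u @ runs True (a # b # as)) p)"
  have "{length u<..length u + sum_list (a # b # as)} =
      {length u<..length u + a + b} \<union> {length ?u<..length ?u + sum_list as}"
    by auto
  then have "(\<Sum>p\<in>{length u<..length u + sum_list (a # b # as)}. ?f p) =
      (\<Sum>p\<in>{length u<..length u + a + b}. ?f p) +
      (\<Sum>p\<in>{length ?u<..length ?u + sum_list as}. ?f p)"
    by (simp only:) (intro sum.union_disjoint, auto)
  then show ?case
    using sum_max_at_run_pair[of a b u "runs True as"] "3.IH"(1)[of ?u] "3.prems"
    by (simp add: sum.lessThan_Suc_shift del: sum.lessThan_Suc)
qed

section \<open>Translation into the counting function \<open>Omega\<close>\<close>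

lemma length_runs [simp]: "length (runs b as) = sum_list as"
  by (induction as arbitrary: b) auto

lemma breakpoint_Cons: "breakpoint (a # as) (Suc k) = a + breakpoint as k"
  by (simp add: breakpoint_def)

text \<open>The induction needs an arbitrary first direction \<open>b\<close> and offset
  \<open>s\<close>. Indices start at 0, so run \<open>k\<close> goes up exactly when
  \<open>even k = b\<close>. Injectivity turns a denied ascent into a strict descent.\<close>

lemma runs_nth_iff:
  assumes "inj \<tau>"
  shows "(\<forall>j<sum_list as. runs b as ! j \<longleftrightarrow> \<tau> (s + j) < \<tau> (Suc (s + j))) \<longleftrightarrow>
    (\<forall>k<length as. if even k = b
      then increases_on \<tau> (s + breakpoint as k) (s + breakpoint as (Suc k))
      else decreases_on \<tau> (s + breakpoint as k) (s + breakpoint as (Suc k)))"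
proof (induction as arbitrary: b s)
  case Nil
  then show ?case by simp
next
  case (Cons a as)
  have flip: "\<tau> (Suc j) < \<tau> j \<longleftrightarrow> \<not> \<tau> j < \<tau> (Suc j)" for j
    using injD[OF assms, of j "Suc j"] by (metis linorder_neqE_nat less_asym n_not_Suc_n)
  have shift: "(\<forall>j\<in>{s..<s + a}. P j) \<longleftrightarrow> (\<forall>j<a. P (s + j))" for P
    by (auto dest!: le_Suc_ex)
  have "(\<forall>j<sum_list (a # as). P j) \<longleftrightarrow> (\<forall>j<a. P j) \<and> (\<forall>j<sum_list as. P (a + j))" for P
  proof (intro iffI conjI allI impI; (elim conjE)?)
    fix j assume P: "\<forall>j<a. P j" "\<forall>j<sum_list as. P (a + j)" and j: "j < sum_list (a # as)"
    show "P j"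
      using P(1) P(2)[rule_format, of "j - a"] j by (cases "j < a") auto
  qed auto
  then have "(\<forall>j<sum_list (a # as). runs b (a # as) ! j \<longleftrightarrow> \<tau> (s + j) < \<tau> (Suc (s + j))) \<longleftrightarrow>
      (\<forall>j<a. b \<longleftrightarrow> \<tau> (s + j) < \<tau> (Suc (s + j))) \<and>
      (\<forall>j<sum_list as. runs (\<not> b) as ! j \<longleftrightarrow> \<tau> (s + a + j) < \<tau> (Suc (s + a + j)))"
    by (simp add: nth_append add.assoc)
  also have "(\<forall>j<a. b \<longleftrightarrow> \<tau> (s + j) < \<tau> (Suc (s + j))) \<longleftrightarrow>
      (if b then increases_on \<tau> s (s + a) else decreases_on \<tau> s (s + a))"
    unfolding increases_on_def decreases_on_def shift by (simp add: flip)
  finally show ?case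
    unfolding Cons.IH
    by (simp add: All_less_Suc2 breakpoint_Cons add.assoc breakpoint_def[of _ 0] cong: if_cong)
qed

lemma Omega_eq_card_with_word: "Omega as = card (with_word (runs True as))"
proof -
  \<comment> \<open>Blocks count from 1 and runs from 0, so the odd blocks are the runs of even
    index, which ascend.\<close>
  have blocks: "(\<forall>k\<in>{1..length as}. P k) \<longleftrightarrow> (\<forall>k<length as. P (Suc k))" for P
    unfolding image_Suc_lessThan[symmetric] by blast
  have "\<tau> \<in> with_word (runs True as) \<longleftrightarrow> \<tau> permutes {0..sum_list as} \<and>
      (\<forall>k\<in>{1..length as}.
        (odd k \<longrightarrow> increases_on \<tau> (breakpoint as (k - 1)) (breakpoint as k)) \<and>
        (even k \<longrightarrow> decreases_on \<tau> (breakpoint as (k - 1)) (breakpoint as k)))" for \<tau>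
    unfolding blocks
    using runs_nth_iff[of \<tau> as True 0]
    by (simp add: with_word_def permutes_inj if_bool_eq_conj cong: conj_cong)
  then show ?thesis
    unfolding Omega_def by (intro arg_cong[where f = card] set_eqI) (simp only: mem_Collect_eq)
qed

theorem theorem1:
  fixes n :: nat and i :: "nat list"
  assumes "n \<ge> 1" and "length i = n" and "\<forall>k<n. i ! k \<ge> 1"
  shows "Omega i = (\<Sum>k<n. Omega (i[k := i ! k - 1]))"
proof -
  let ?w = "runs True i"
  have pos: "\<forall>a\<in>set i. a \<ge> 1"
    using assms(2,3) by (auto simp: in_set_conv_nth)
  obtain a as where i: "i = a # as" "a \<ge> 1"
    using assms(1,2) pos by (cases i) auto
  \<comment> \<open>Position 0 lies in none of the left-open intervals. It cannot carry the maximum,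
    since the first run is nonempty and ascends.\<close>
  have "with_max_at ?w 0 = {}"
    using i by (intro with_max_at_ascent) (auto simp: nth_append)
  then have "Omega i = (\<Sum>p\<in>{0<..sum_list i}. card (with_max_at ?w p))"
    by (simp add: Omega_eq_card_with_word card_with_word_max sum.head)
  then show ?thesis
    using sum_max_at_runs[OF pos, of "[]"] assms(2) by (simp add: Omega_eq_card_with_word)
qed

end
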